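(* Let $\vartheta$ be a primitive random substitution with RS-subshift $X_\vartheta$, and let $w$ be any element of $X_\vartheta$. Then $$X_\vartheta=\overline{\{S^k(x) : x \text{ is a realisation of } \vartheta^m(w),\ k\in\mathbb Z,\ m\ge 0\}},$$ where all possible realisations of $\vartheta^m(w)$ are allowed and the closure is taken in $\mathcal A^{\mathbb Z}$.
   Context: Let $\mathcal A=\{a_1,\dots,a_n\}$ be a finite alphabet, $\mathcal A^+$ the set of non-empty finite words over $\mathcal A$, and $\mathcal A^{\mathbb Z}$ the set of bi-infinite sequences with the product topology ($\mathcal A$ discrete). A random substitution (non-degenerate; the probabilities, all non-zero, play no role here and are suppressed) is a map $\vartheta$ assigning to each letter $a_i$ a non-empty finite set $\vartheta(a_i)\subset\mathcal A^+$ of realisations. A realisation of $\vartheta(u)$, for $u=u_1\cdots u_m\in\mathcal A^+$, is a word $x_1\cdots x_m$ with each $x_j\in\vartheta(u_j)$ chosen independently for each position; for $w\in\mathcal A^{\mathbb Z}$, a realisation of $\vartheta(w)$ is a bi-infinite concatenation $\cdots x_{-1}x_0x_1\cdots$ with each $x_j\in\vartheta(w_j)$ chosen independently and with $x_0$ starting at position $0$. Realisations of $\vartheta^k$ are defined inductively: $\vartheta^0$ is the identity, and the realisations of $\vartheta^{k+1}(u)$ are the realisations of $\vartheta(v)$ for $v$ a realisation of $\vartheta^k(u)$. $\vartheta$ is primitive if there is $k\in\mathbb N$ such that for all $1\le i,j\le n$ the letter $a_i$ is a subword of some realisation of $\vartheta^k(a_j)$. A word $u\in\mathcal A^+$ is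 $\vartheta$-legal if it is a subword of some realisation of $\vartheta^k(a_j)$ for some $k\in\mathbb N$ and some $j$. The RS-subshift is $X_\vartheta=\{w\in\mathcal A^{\mathbb Z}: \text{every finite non-empty subword of } w \text{ is } \vartheta\text{-legal}\}$, with the shift $S(w)_i=w_{i+1}$. *)

theory Defs
  imports "HOL-Analysis.Analysis" "HOL-Library.Sublist"
begin

text \<open>The finite alphabet is a type of class \<^class>\<open>finite\<close>, finite words are lists, and
  bi-infinite sequences are functions on the integers.\<close>

definition random_substitution :: "('a::finite \<Rightarrow> 'a list set) \<Rightarrow> bool" where
  "random_substitution \<theta> \<longleftrightarrow> (\<forall>a. finite (\<theta> a) \<and> \<theta> a \<noteq> {} \<and> [] \<notin> \<theta> a)"

definition realisations :: "('a::finite \<Rightarrow> 'a list set) \<Rightarrow> 'a list \<Rightarrow> 'a list set" where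
  "realisations \<theta> u =
     {concat xs | xs. length xs = length u \<and> (\<forall>j<length u. xs ! j \<in> \<theta> (u ! j))}"

primrec realisations_pow ::
    "('a::finite \<Rightarrow> 'a list set) \<Rightarrow> nat \<Rightarrow> 'a list \<Rightarrow> 'a list set" where
  "realisations_pow \<theta> 0 u = {u}"
| "realisations_pow \<theta> (Suc k) u = (\<Union>v\<in>realisations_pow \<theta> k u. realisations \<theta> v)"

definition primitive :: "('a::finite \<Rightarrow> 'a list set) \<Rightarrow> bool" where
  "primitive \<theta> \<longleftrightarrow> (\<exists>k. \<forall>a b. \<exists>v\<in>realisations_pow \<theta> k [b]. sublist [a] v)"

definition legal :: "('a::finite \<Rightarrow> 'a list set) \<Rightarrow> 'a list \<Rightarrow> bool" where
  "legal \<theta> u \<longleftrightarrow> u \<noteq> [] \<and> (\<exists>k a. \<exists>v\<in>realisations_pow \<theta> k [a]. sublist u v)"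

definition biinf_subword :: "'a list \<Rightarrow> (int \<Rightarrow> 'a) \<Rightarrow> bool" where
  "biinf_subword u w \<longleftrightarrow> (\<exists>i. \<forall>j<length u. w (i + int j) = u ! j)"

definition RS_subshift :: "('a::finite \<Rightarrow> 'a list set) \<Rightarrow> (int \<Rightarrow> 'a) set" where
  "RS_subshift \<theta> = {w. \<forall>u. u \<noteq> [] \<and> biinf_subword u w \<longrightarrow> legal \<theta> u}"

text \<open>The position at which the block \<open>x j\<close> starts in the bi-infinite concatenation of the
  blocks, normalised so that \<open>x 0\<close> starts at position 0.\<close>

definition block_start :: "(int \<Rightarrow> 'a list) \<Rightarrow> int \<Rightarrow> int" where
  "block_start x j =
     (if 0 \<le> j then (\<Sum>i\<in>{0..<j}. int (length (x i))) else - (\<Sum>i\<in>{j..<0}. int (length (x i))))"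

lemma block_start_0: "block_start x 0 = 0"
  by (simp add: block_start_def)

lemma block_start_Suc: "block_start x (j + 1) = block_start x j + int (length (x j))"
proof -
  consider "0 \<le> j" | "j = -1" | "j < -1" by linarith
  then show ?thesis
  proof cases
    case 1
    then have "{0..<j + 1} = insert j {0..<j}" by auto
    with 1 show ?thesis by (simp add: block_start_def)
  next
    case 2
    then have "{j..<0} = {-1}" by auto
    with 2 show ?thesis by (simp add: block_start_def)
  next
    case 3
    then have "{j..<0} = insert j {j + 1..<0}" by auto
    with 3 show ?thesis by (simp add: block_start_def)
  qed
qed

text \<open>When infinitely many blocks on either side are non-empty, as is the case for realisations of
  a random substitution, the blocks cover all positions, so \<open>y\<close> is determined by \<open>x\<close>.\<close>

definition biinf_concat :: "(int \<Rightarrow> 'a list) \<Rightarrow> (int \<Rightarrow> 'a) \<Rightarrow> bool" where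
  "biinf_concat x y \<longleftrightarrow> (\<forall>j. \<forall>i<length (x j). y (block_start x j + int i) = x j ! i)"

definition biinf_realisations ::
    "('a::finite \<Rightarrow> 'a list set) \<Rightarrow> (int \<Rightarrow> 'a) \<Rightarrow> (int \<Rightarrow> 'a) set" where
  "biinf_realisations \<theta> w = {y. \<exists>x. (\<forall>j. x j \<in> \<theta> (w j)) \<and> biinf_concat x y}"

primrec biinf_realisations_pow ::
    "('a::finite \<Rightarrow> 'a list set) \<Rightarrow> nat \<Rightarrow> (int \<Rightarrow> 'a) \<Rightarrow> (int \<Rightarrow> 'a) set" where
  "biinf_realisations_pow \<theta> 0 w = {w}"
| "biinf_realisations_pow \<theta> (Suc k) w =
     (\<Union>v\<in>biinf_realisations_pow \<theta> k w. biinf_realisations \<theta> v)"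

definition shift :: "(int \<Rightarrow> 'a) \<Rightarrow> int \<Rightarrow> 'a" where
  "shift w = (\<lambda>i. w (i + 1))"

definition shift_pow :: "int \<Rightarrow> (int \<Rightarrow> 'a) \<Rightarrow> int \<Rightarrow> 'a" where
  "shift_pow k = (if 0 \<le> k then shift ^^ nat k else inv shift ^^ nat (- k))"

lemma inv_shift: "inv shift = (\<lambda>w i. w (i - 1))"
  by (rule inv_unique_comp) (auto simp: shift_def fun_eq_iff)

lemma shift_pow_apply: "shift_pow k w = (\<lambda>i. w (i + k))"
proof -
  have pos: "(shift ^^ n) w = (\<lambda>i. w (i + int n))" for n
    by (induction n) (auto simp: shift_def fun_eq_iff add_ac)
  have neg: "(inv shift ^^ n) w = (\<lambda>i. w (i - int n))" for n
    by (induction n) (auto simp: inv_shift fun_eq_iff algebra_simps)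
  show ?thesis by (auto simp: shift_pow_def pos neg)
qed

definition full_shift_topology :: "(int \<Rightarrow> 'a::finite) topology" where
  "full_shift_topology = product_topology (\<lambda>_. discrete_topology UNIV) UNIV"

end

theory Submission
  imports Defs
begin

text \<open>Inclusion of the closure holds because substituting maps the subshift into itself and the
  subshift is closed and shift-invariant. Conversely, a legal word occurs in a realisation of
  \<open>\<theta>\<^sup>m\<close> on some letter, and by primitivity that letter occurs in a realisation of \<open>\<theta>\<^sup>k\<close> on
  \<open>w 0\<close>; hence the word occurs in a realisation of \<open>\<theta>\<^sup>k\<^sup>+\<^sup>m\<close> on \<open>w\<close>. Every central window of
  a point of the subshift is thus a window of the orbit set.\<close>

subsection \<open>Realisations of finite words\<close>

text \<open>\<open>list_all2\<close> splits along \<open>@\<close>, so this form makes the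
  concatenation of realisations immediate.\<close>

lemma realisations_list_all2:
  "realisations \<theta> u = {concat xs | xs. list_all2 (\<lambda>x a. x \<in> \<theta> a) xs u}"
  unfolding realisations_def list_all2_conv_all_nth by auto

lemma realisations_append:
  assumes "r \<in> realisations \<theta> u" "s \<in> realisations \<theta> v"
  shows "r @ s \<in> realisations \<theta> (u @ v)"
proof -
  obtain xs ys where "r = concat xs" "list_all2 (\<lambda>x a. x \<in> \<theta> a) xs u"
    "s = concat ys" "list_all2 (\<lambda>x a. x \<in> \<theta> a) ys v"
    using assms unfolding realisations_list_all2 by auto
  then have "r @ s = concat (xs @ ys)" "list_all2 (\<lambda>x a. x \<in> \<theta> a) (xs @ ys) (u @ v)"
    by (simp_all add: list_all2_appendI)
  then show ?thesis unfolding realisations_list_all2 by blast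
qed

lemma realisations_nonempty:
  assumes "random_substitution \<theta>"
  obtains r where "r \<in> realisations \<theta> u"
proof
  have "(SOME x. x \<in> \<theta> a) \<in> \<theta> a" for a
    using assms by (simp add: random_substitution_def some_in_eq)
  then have "list_all2 (\<lambda>x a. x \<in> \<theta> a) (map (\<lambda>a. SOME x. x \<in> \<theta> a) u) u"
    by (simp add: list_all2_conv_all_nth)
  then show "concat (map (\<lambda>a. SOME x. x \<in> \<theta> a) u) \<in> realisations \<theta> u"
    unfolding realisations_list_all2 by blast
qed

text \<open>The letters to the left and right of the occurrence of \<open>u\<close> receive
  arbitrary realisations, which exist because each \<open>\<theta> a\<close> is non-empty.\<close>

lemma realisations_sublist:
  assumes "random_substitution \<theta>" "sublist u v" "r \<in> realisations \<theta> u"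
  obtains s where "s \<in> realisations \<theta> v" "sublist r s"
proof -
  obtain p q where v: "v = p @ u @ q"
    using assms(2) by (auto simp: sublist_def)
  obtain p' q' where "p' \<in> realisations \<theta> p" "q' \<in> realisations \<theta> q"
    using realisations_nonempty[OF assms(1)] by metis
  then have "p' @ r @ q' \<in> realisations \<theta> v"
    unfolding v using assms(3) by (intro realisations_append)
  then show thesis by (rule that) simp
qed

lemma realisations_pow_sublist:
  assumes "random_substitution \<theta>" "sublist u v" "r \<in> realisations_pow \<theta> k u"
  shows "\<exists>s\<in>realisations_pow \<theta> k v. sublist r s"
  using assms(3)
proof (induction k arbitrary: r)
  case 0
  with assms(2) show ?case by simp
next
  case (Suc k)
  then obtain t where t: "t \<in> realisations_pow \<theta> k u" "r \<in> realisations \<theta> t" by auto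
  from Suc.IH[OF t(1)] obtain t' where t': "t' \<in> realisations_pow \<theta> k v" "sublist t t'" by auto
  obtain s where "s \<in> realisations \<theta> t'" "sublist r s"
    using realisations_sublist[OF assms(1) t'(2) t(2)] .
  with t'(1) show ?case by auto
qed

lemma realisations_pow_add:
  assumes "r \<in> realisations_pow \<theta> k u" "s \<in> realisations_pow \<theta> m r"
  shows "s \<in> realisations_pow \<theta> (k + m) u"
  using assms(2)
proof (induction m arbitrary: s)
  case 0
  with assms(1) show ?case by simp
next
  case (Suc m)
  then show ?case by auto
qed

text \<open>If \<open>v\<close> sits in a level-\<open>k\<close> word \<open>t\<close>, then
  \<open>r\<close> extends to a realisation of all of \<open>t\<close>, so \<open>u\<close> sits in
  a word of level \<open>Suc k\<close> grown from the same letter.\<close>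

lemma legal_realisation:
  assumes "random_substitution \<theta>" "legal \<theta> v" "r \<in> realisations \<theta> v" "sublist u r" "u \<noteq> []"
  shows "legal \<theta> u"
proof -
  obtain k a t where t: "t \<in> realisations_pow \<theta> k [a]" "sublist v t"
    using assms(2) by (auto simp: legal_def)
  obtain s where "s \<in> realisations \<theta> t" "sublist r s"
    using realisations_sublist[OF assms(1) t(2) assms(3)] .
  then have "s \<in> realisations_pow \<theta> (Suc k) [a]" "sublist u s"
    using t(1) assms(4) sublist_order.order_trans by auto
  with assms(5) show ?thesis unfolding legal_def by blast
qed

text \<open>Primitivity frees the choice of the seed letter \<open>b\<close>, which is later taken
  from the given sequence.\<close>

lemma legal_in_realisations_pow:
  assumes "random_substitution \<theta>" "primitive \<theta>" "legal \<theta> u"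
  obtains m v where "v \<in> realisations_pow \<theta> m [b]" "sublist u v"
proof -
  obtain m a t where t: "t \<in> realisations_pow \<theta> m [a]" "sublist u t"
    using assms(3) by (auto simp: legal_def)
  obtain k r where r: "r \<in> realisations_pow \<theta> k [b]" "sublist [a] r"
    using assms(2) unfolding primitive_def by blast
  obtain s where s: "s \<in> realisations_pow \<theta> m r" "sublist t s"
    using realisations_pow_sublist[OF assms(1) r(2) t(1)] by auto
  show thesis
    using that[OF realisations_pow_add[OF r(1) s(1)]] t(2) s(2) sublist_order.order_trans by blast
qed

subsection \<open>Bi-infinite concatenations\<close>

lemma block_start_add:
  "block_start x (i + int n) = block_start x i + int (length (concat (map (\<lambda>j. x (i + int j)) [0..<n])))"
proof (induction n)
  case (Suc n)
  then show ?case using block_start_Suc[of x "i + int n"] by (simp add: add_ac)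
qed simp

text \<open>Every non-empty block advances the start by at least one. This linear growth gives both
  the disjointness of blocks and the covering of finite windows.\<close>

lemma block_start_diff_ge:
  assumes "\<And>j. x j \<noteq> []" "i \<le> j"
  shows "j - i \<le> block_start x j - block_start x i"
  using assms(2)
proof (induction j rule: int_ge_induct)
  case (step j)
  have "int (length (x j)) \<ge> 1" using assms(1)[of j] by (cases "x j") auto
  with step show ?case by (simp add: block_start_Suc)
qed simp

text \<open>Were \<open>i < j\<close>, the start of block \<open>i + 1\<close> would lie at or
  before that of block \<open>j\<close>, forcing \<open>p < p\<close>; the other case is
  symmetric.\<close>

lemma block_start_unique:
  assumes ne: "\<And>j. x j \<noteq> []"
    and "block_start x i \<le> p" "p < block_start x (i + 1)"
    and "block_start x j \<le> p" "p < block_start x (j + 1)"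
  shows "i = j"
proof (rule ccontr)
  assume "i \<noteq> j"
  then consider "i + 1 \<le> j" | "j + 1 \<le> i" by linarith
  then show False
    using block_start_diff_ge[of x "i + 1" j, OF ne] block_start_diff_ge[of x "j + 1" i, OF ne] assms
    by cases linarith+
qed

lemma biinf_concat_exists:
  assumes ne: "\<And>j. x j \<noteq> []"
  obtains y where "biinf_concat x y"
proof
  let ?B = "\<lambda>p j. block_start x j \<le> p \<and> p < block_start x (j + 1)"
  \<comment> \<open>Position \<open>p\<close> is read off the block whose interval contains it, at
    the offset from that block's start; disjointness of the intervals lets \<open>THE\<close> find
    the block.\<close>
  let ?y = "\<lambda>p. let j = THE j. ?B p j in x j ! nat (p - block_start x j)"
  show "biinf_concat x ?y"
    unfolding biinf_concat_def
  proof (intro allI impI)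
    fix j i assume "i < length (x j)"
    then have B: "?B (block_start x j + int i) j" by (simp add: block_start_Suc)
    then have "(THE j'. ?B (block_start x j + int i) j') = j"
      using block_start_unique[of x, OF ne] by (intro the_equality) blast+
    then show "?y (block_start x j + int i) = x j ! i" by simp
  qed
qed

text \<open>The bridge from bi-infinite to finite concatenation: when a block is appended, a
  position lies either among the earlier blocks or in the new one.\<close>

lemma biinf_concat_blocks:
  assumes "biinf_concat x y" "p < length (concat (map (\<lambda>j. x (i + int j)) [0..<n]))"
  shows "y (block_start x i + int p) = concat (map (\<lambda>j. x (i + int j)) [0..<n]) ! p"
  using assms(2)
proof (induction n)
  case (Suc n)
  let ?c = "concat (map (\<lambda>j. x (i + int j)) [0..<n])"
  show ?case
  proof (cases "p < length ?c")
    case True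
    with Suc.IH show ?thesis by (simp add: nth_append)
  next
    case False
    then have p: "block_start x i + int p = block_start x (i + int n) + int (p - length ?c)"
      by (simp add: block_start_add)
    have "p - length ?c < length (x (i + int n))" using Suc.prems False by simp
    then have "y (block_start x i + int p) = x (i + int n) ! (p - length ?c)"
      unfolding p using assms(1) by (simp add: biinf_concat_def)
    with False show ?thesis by (simp add: nth_append)
  qed
qed simp

lemma biinf_subword_append:
  assumes "biinf_subword (p @ u @ s) w"
  shows "biinf_subword u w"
proof -
  obtain i where i: "\<And>j. j < length (p @ u @ s) \<Longrightarrow> w (i + int j) = (p @ u @ s) ! j"
    using assms by (auto simp: biinf_subword_def)
  have "w (i + int (length p) + int j) = u ! j" if "j < length u" for j
    using i[of "length p + j"] that by (simp add: nth_append add.assoc)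
  then show ?thesis unfolding biinf_subword_def by blast
qed

lemma biinf_subword_sublist:
  assumes "biinf_subword v w" "sublist u v"
  shows "biinf_subword u w"
  using assms biinf_subword_append by (auto simp: sublist_def)

text \<open>Since blocks are non-empty, \<open>block_start x j\<close> lies beyond \<open>j\<close> on either side of 0, so the
  blocks with indices between \<open>min 0 p\<close> and \<open>max 0 (p + length u)\<close> cover an occurrence of \<open>u\<close>
  at \<open>p\<close>.\<close>

lemma biinf_realisations_subword:
  assumes rs: "random_substitution \<theta>" and y: "y \<in> biinf_realisations \<theta> w"
    and u: "biinf_subword u y"
  obtains v r where "biinf_subword v w" "r \<in> realisations \<theta> v" "sublist u r"
proof -
  obtain x where x: "\<And>j. x j \<in> \<theta> (w j)" and conc: "biinf_concat x y"
    using y by (auto simp: biinf_realisations_def)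
  have ne: "x j \<noteq> []" for j
    using rs x[of j] by (metis random_substitution_def)
  obtain p where p: "\<And>j. j < length u \<Longrightarrow> y (p + int j) = u ! j"
    using u by (auto simp: biinf_subword_def)
  define i where "i = min 0 p"
  define n where "n = nat (max 0 (p + int (length u)) - i)"
  define v where "v = map (\<lambda>j. w (i + int j)) [0..<n]"
  define r where "r = concat (map (\<lambda>j. x (i + int j)) [0..<n])"
  have lo: "block_start x i \<le> p"
    using block_start_diff_ge[of x i 0, OF ne] by (simp add: i_def block_start_0)
  have n: "i + int n = max 0 (p + int (length u))"
    by (simp add: n_def i_def)
  have "p + int (length u) \<le> block_start x (i + int n)"
    unfolding n using block_start_diff_ge[of x 0 "max 0 (p + int (length u))", OF ne]
    by (simp add: block_start_0)
  then have hi: "p + int (length u) \<le> block_start x i + int (length r)"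
    by (simp add: block_start_add r_def)
  \<comment> \<open>The offset of the occurrence inside \<open>r\<close>; by \<open>lo\<close> the
    difference is nonnegative, so \<open>nat\<close> does not truncate it.\<close>
  define d where "d = nat (p - block_start x i)"
  have len: "d + length u \<le> length r"
    using lo hi by (simp add: d_def)
  have "u = take (length u) (drop d r)"
  proof (rule nth_equalityI)
    fix j assume j: "j < length u"
    then have "r ! (d + j) = y (block_start x i + int (d + j))"
      unfolding r_def using len by (intro biinf_concat_blocks[OF conc, symmetric]) (simp add: r_def)
    also have "block_start x i + int (d + j) = p + int j"
      using lo by (simp add: d_def)
    finally show "u ! j = take (length u) (drop d r) ! j"
      using p[OF j] j len by simp
  qed (use len in simp)
  then have "sublist u r"
    by (metis sublist_take sublist_drop sublist_order.order_trans)
  moreover have "biinf_subword v w"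
    unfolding biinf_subword_def v_def by (intro exI[of _ i]) simp
  moreover have "r \<in> realisations \<theta> v"
    unfolding realisations_list_all2 r_def v_def
    using x by (auto simp: list_all2_conv_all_nth)
  ultimately show thesis using that by blast
qed

text \<open>The bi-infinite analogue of extending a realisation from a sublist: the blocks over one
  occurrence of \<open>u\<close> are prescribed, all others are chosen freely.\<close>

lemma biinf_realisations_extend:
  assumes rs: "random_substitution \<theta>" and u: "biinf_subword u w" and r: "r \<in> realisations \<theta> u"
  obtains y where "y \<in> biinf_realisations \<theta> w" "biinf_subword r y"
proof -
  obtain xs where xs: "r = concat xs" "length xs = length u"
    "\<And>j. j < length u \<Longrightarrow> xs ! j \<in> \<theta> (u ! j)"
    using r by (auto simp: realisations_def)
  obtain i where i: "\<And>j. j < length u \<Longrightarrow> w (i + int j) = u ! j"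
    using u by (auto simp: biinf_subword_def)
  define x where "x j = (if i \<le> j \<and> j < i + int (length u) then xs ! nat (j - i)
    else SOME b. b \<in> \<theta> (w j))" for j
  have x: "x j \<in> \<theta> (w j)" for j
  proof (cases "i \<le> j \<and> j < i + int (length u)")
    case True
    then have "nat (j - i) < length u" by linarith
    with True xs(3)[of "nat (j - i)"] i[of "nat (j - i)"] show ?thesis by (simp add: x_def)
  next
    case False
    with rs show ?thesis by (auto simp: x_def random_substitution_def some_in_eq)
  qed
  then have "x j \<noteq> []" for j
    using rs by (metis random_substitution_def)
  then obtain y where y: "biinf_concat x y"
    using biinf_concat_exists by blast
  have "map (\<lambda>j. x (i + int j)) [0..<length u] = xs"
    by (rule nth_equalityI) (simp_all add: xs(2) x_def)
  then have "biinf_subword r y"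
    unfolding biinf_subword_def xs(1) using biinf_concat_blocks[OF y, of _ i "length u"] by auto
  moreover have "y \<in> biinf_realisations \<theta> w"
    using x y by (auto simp: biinf_realisations_def)
  ultimately show thesis using that by blast
qed

lemma biinf_realisations_pow_extend:
  assumes "random_substitution \<theta>" "biinf_subword u w" "r \<in> realisations_pow \<theta> m u"
  shows "\<exists>y\<in>biinf_realisations_pow \<theta> m w. biinf_subword r y"
  using assms(3)
proof (induction m arbitrary: r)
  case 0
  with assms(2) show ?case by simp
next
  case (Suc m)
  then obtain t where t: "t \<in> realisations_pow \<theta> m u" "r \<in> realisations \<theta> t" by auto
  from Suc.IH[OF t(1)] obtain z where z: "z \<in> biinf_realisations_pow \<theta> m w" "biinf_subword t z"
    by auto
  obtain y where "y \<in> biinf_realisations \<theta> z" "biinf_subword r y"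
    using biinf_realisations_extend[OF assms(1) z(2) t(2)] .
  with z(1) show ?case by auto
qed

subsection \<open>The subshift\<close>

lemma biinf_realisations_RS_subshift:
  assumes "random_substitution \<theta>" "w \<in> RS_subshift \<theta>" "y \<in> biinf_realisations \<theta> w"
  shows "y \<in> RS_subshift \<theta>"
  unfolding RS_subshift_def
proof (intro CollectI allI impI, elim conjE)
  fix u assume u: "u \<noteq> []" "biinf_subword u y"
  obtain v r where v: "biinf_subword v w" "r \<in> realisations \<theta> v" "sublist u r"
    using biinf_realisations_subword[OF assms(1,3) u(2)] .
  \<comment> \<open>The empty word has only the empty realisation, which cannot contain
    \<open>u\<close>; membership in the subshift speaks only about non-empty words.\<close>
  have "v \<noteq> []"
    using v(2,3) u(1) by (auto simp: realisations_def)
  then have "legal \<theta> v"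
    using assms(2) v(1) by (auto simp: RS_subshift_def)
  then show "legal \<theta> u"
    using legal_realisation[OF assms(1) _ v(2,3) u(1)] by blast
qed

lemma biinf_realisations_pow_RS_subshift:
  assumes "random_substitution \<theta>" "w \<in> RS_subshift \<theta>" "y \<in> biinf_realisations_pow \<theta> m w"
  shows "y \<in> RS_subshift \<theta>"
  using assms(3)
  by (induction m arbitrary: y) (use assms(1,2) biinf_realisations_RS_subshift in auto)

lemma biinf_subword_shift_pow:
  "biinf_subword u (shift_pow k w) \<longleftrightarrow> biinf_subword u w"
proof
  assume "biinf_subword u (shift_pow k w)"
  then obtain i where "\<forall>j<length u. w (i + int j + k) = u ! j"
    by (auto simp: biinf_subword_def shift_pow_apply)
  then show "biinf_subword u w"
    unfolding biinf_subword_def by (intro exI[of _ "i + k"]) (simp add: add_ac)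
next
  assume "biinf_subword u w"
  then obtain i where "\<forall>j<length u. w (i + int j) = u ! j"
    by (auto simp: biinf_subword_def)
  then show "biinf_subword u (shift_pow k w)"
    unfolding biinf_subword_def shift_pow_apply by (intro exI[of _ "i - k"]) simp
qed

section \<open>Closure in the product topology\<close>

text \<open>As the alphabet is discrete, the cylinders fixing finitely many coordinates of
  \<open>x\<close> form a neighbourhood base at \<open>x\<close>.\<close>

lemma in_full_shift_closure_of:
  "x \<in> full_shift_topology closure_of S \<longleftrightarrow> (\<forall>F. finite F \<longrightarrow> (\<exists>y\<in>S. \<forall>i\<in>F. y i = x i))"
  (is "?L \<longleftrightarrow> ?R")
proof
  assume L: ?L
  show ?R
  proof (intro allI impI)
    fix F :: "int set" assume F: "finite F"
    \<comment> \<open>The cylinder of sequences agreeing with \<open>x\<close> on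
      \<open>F\<close>.\<close>
    define T where "T = PiE UNIV (\<lambda>i. if i \<in> F then {x i} else UNIV)"
    have "openin full_shift_topology T"
      unfolding full_shift_topology_def T_def
      unfolding openin_PiE_gen by (auto intro: finite_subset[OF _ F])
    moreover have "x \<in> T" by (auto simp: T_def)
    ultimately obtain y where "y \<in> S" "y \<in> T"
      using L unfolding in_closure_of by blast
    then show "\<exists>y\<in>S. \<forall>i\<in>F. y i = x i"
      by (intro bexI[of _ y]) (auto simp: T_def PiE_iff split: if_splits)
  qed
next
  assume R: ?R
  show ?L
    unfolding in_closure_of
  proof (intro conjI allI impI)
    show "x \<in> topspace full_shift_topology"
      by (simp add: full_shift_topology_def)
    fix T assume "x \<in> T \<and> openin full_shift_topology T"
    then obtain U where U: "finite {i. U i \<noteq> UNIV}" "x \<in> PiE UNIV U" "PiE UNIV U \<subseteq> T"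
      unfolding full_shift_topology_def openin_product_topology_alt by auto
    from R U(1) obtain y where y: "y \<in> S" "\<forall>i\<in>{i. U i \<noteq> UNIV}. y i = x i" by meson
    have "y i \<in> U i" for i
      using y(2) U(2) by (cases "U i = UNIV") (auto simp: PiE_iff)
    then have "y \<in> PiE UNIV U" by (simp add: PiE_iff)
    then show "\<exists>y. y \<in> S \<and> y \<in> T"
      using y(1) U(3) by blast
  qed
qed

text \<open>Each subword of \<open>z\<close> occupies a finite window, and some point of
  \<open>S\<close> agrees with \<open>z\<close> there, so the subword inherits legality from
  \<open>S\<close>.\<close>

lemma closure_of_subset_RS_subshift:
  assumes "S \<subseteq> RS_subshift \<theta>"
  shows "full_shift_topology closure_of S \<subseteq> RS_subshift \<theta>"
proof
  fix z assume z: "z \<in> full_shift_topology closure_of S"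
  show "z \<in> RS_subshift \<theta>"
    unfolding RS_subshift_def
  proof (intro CollectI allI impI, elim conjE)
    fix u assume u: "u \<noteq> []" "biinf_subword u z"
    then obtain i where i: "\<forall>j<length u. z (i + int j) = u ! j"
      by (auto simp: biinf_subword_def)
    obtain y where y: "y \<in> S" "\<forall>j\<in>{i..<i + int (length u)}. y j = z j"
      using z unfolding in_full_shift_closure_of by (meson finite_atLeastLessThan_int)
    then have "biinf_subword u y"
      unfolding biinf_subword_def using i by (intro exI[of _ i]) auto
    with u(1) y(1) assms show "legal \<theta> u"
      by (auto simp: RS_subshift_def)
  qed
qed

section \<open>Density of the orbit set\<close>

lemma RS_subshift_subset_closure_of_orbit:
  assumes rs: "random_substitution \<theta>" and prim: "primitive \<theta>"
  shows "RS_subshift \<theta> \<subseteq> full_shift_topology closure_of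
    {shift_pow k x | k m x. x \<in> biinf_realisations_pow \<theta> m w}"
proof
  fix z assume z: "z \<in> RS_subshift \<theta>"
  show "z \<in> full_shift_topology closure_of
    {shift_pow k x | k m x. x \<in> biinf_realisations_pow \<theta> m w}" (is "_ \<in> _ closure_of ?D")
    unfolding in_full_shift_closure_of
  proof (intro allI impI)
    fix F :: "int set" assume "finite F"
    then obtain a b where F: "F \<subseteq> {a..b}"
      by (metis bdd_above_finite bdd_below_finite bdd_above.E bdd_below.E atLeastAtMost_iff subsetI)
    \<comment> \<open>Taking the maximum keeps the window from \<open>a\<close> to \<open>c\<close>
      non-empty even when \<open>{a..b}\<close> is empty, so that \<open>u\<close> is a non-empty
      word.\<close>
    define c where "c = max a b"
    define u where "u = map (\<lambda>j. z (a + int j)) [0..<Suc (nat (c - a))]"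
    have "biinf_subword u z"
      unfolding biinf_subword_def u_def by (intro exI[of _ a]) (simp del: upt_Suc)
    moreover have "u \<noteq> []" by (simp add: u_def)
    ultimately have "legal \<theta> u"
      using z by (auto simp: RS_subshift_def)
    then obtain m v where v: "v \<in> realisations_pow \<theta> m [w 0]" "sublist u v"
      using legal_in_realisations_pow[OF rs prim] by metis
    have "biinf_subword [w 0] w"
      unfolding biinf_subword_def by (intro exI[of _ 0]) simp
    then obtain x where x: "x \<in> biinf_realisations_pow \<theta> m w" "biinf_subword v x"
      using biinf_realisations_pow_extend[OF rs _ v(1)] by blast
    obtain i where i: "\<And>j. j < length u \<Longrightarrow> x (i + int j) = u ! j"
      using biinf_subword_sublist[OF x(2) v(2)] by (auto simp: biinf_subword_def)
    \<comment> \<open>The word \<open>u\<close> occurs in \<open>x\<close> at \<open>i\<close> and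
      in \<open>z\<close> at \<open>a\<close>; shifting by \<open>i - a\<close> aligns the two
      occurrences.\<close>
    have "shift_pow (i - a) x p = z p" if "p \<in> F" for p
    proof -
      have p: "a \<le> p" "p \<le> c" using that F by (auto simp: c_def)
      then have "nat (p - a) < Suc (nat (c - a))" by simp
      then show ?thesis
        using i[of "nat (p - a)"] p by (simp add: u_def shift_pow_apply algebra_simps del: upt_Suc)
    qed
    moreover have "shift_pow (i - a) x \<in> ?D" using x(1) by blast
    ultimately show "\<exists>y\<in>?D. \<forall>p\<in>F. y p = z p" by blast
  qed
qed

theorem proposition10:
  fixes \<theta> :: "'a::finite \<Rightarrow> 'a list set" and w :: "int \<Rightarrow> 'a"
  assumes "random_substitution \<theta>"
    and "primitive \<theta>"
    and "w \<in> RS_subshift \<theta>"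
  shows "RS_subshift \<theta> =
    full_shift_topology closure_of
      {shift_pow k x | k m x. x \<in> biinf_realisations_pow \<theta> m w}"
proof
  show "RS_subshift \<theta> \<subseteq> full_shift_topology closure_of
      {shift_pow k x | k m x. x \<in> biinf_realisations_pow \<theta> m w}"
    using assms(1,2) by (rule RS_subshift_subset_closure_of_orbit)
  \<comment> \<open>Shifting leaves the set of subwords unchanged, hence also membership in the
    subshift.\<close>
  have "shift_pow k x \<in> RS_subshift \<theta>" if "x \<in> biinf_realisations_pow \<theta> m w" for k m x
    using biinf_realisations_pow_RS_subshift[OF assms(1,3) that]
    by (simp add: RS_subshift_def biinf_subword_shift_pow)
  then show "full_shift_topology closure_of
      {shift_pow k x | k m x. x \<in> biinf_realisations_pow \<theta> m w} \<subseteq> RS_subshift \<theta>"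
    by (intro closure_of_subset_RS_subshift) blast
qed

end
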